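(* Let $\Omega\subset\mathbb{R}^n$ be a bounded domain, $0<\alpha\le1$, and $\lambda\in\mathbb{R}$. Let $u\in C_0(\overline\Omega)$, $u\not\equiv0$, be a non-negative viscosity solution of $$\max\left\{\mathcal{L}_\infty u(x),\ \mathcal{L}_\infty^-u(x)+\lambda u(x)\right\}=0\quad\text{in }\Omega .$$ Then $\lambda=\Lambda_\infty^\alpha$, where $\Lambda_\infty^\alpha=R^{-\alpha}$ and $R=\max_{x\in\Omega}\operatorname{dist}(x,\mathbb{R}^n\setminus\Omega)$.
   Context: For a function $u$ on $\mathbb{R}^n$, $$\mathcal{L}^+_\infty u(x)=\sup_{y\in\mathbb{R}^n,\,y\ne x}\frac{u(y)-u(x)}{|y-x|^\alpha},\quad \mathcal{L}^-_\infty u(x)=\inf_{y\in\mathbb{R}^n,\,y\neq x}\frac{u(y)-u(x)}{|y-x|^\alpha},\quad \mathcal{L}_\infty u=\mathcal{L}_\infty^+u+\mathcal{L}_\infty^-u .$$ $C_0(\overline\Omega)$ denotes the continuous functions on $\overline\Omega$ vanishing on $\partial\Omega$, extended by zero to $\mathbb{R}^n$. $C_0^1(\mathbb{R}^n)$ denotes compactly supported $C^1$ functions. A function $\phi$ touches $u$ from below (above) at $x_0$ if $\phi(x_0)=u(x_0)$ and $\phi\le u$ ($\phi\ge u$) in $\mathbb{R}^n$. The function $u$ is a viscosity supersolution of $\max\{\mathcal{L}_\infty u,\mathcal{L}_\infty^-u+\lambda u\}=0$ in $\Omega$ if $\mathcal{L}_\infty\phi(x_0)\le0$ and $\mathcal{L}_\infty^-\phi(x_0)+\lambda\phi(x_0)\le0$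 whenever $\phi\in C_0^1(\mathbb{R}^n)$ touches $u$ from below at $x_0\in\Omega$; a viscosity subsolution if $\mathcal{L}_\infty\psi(x_0)\ge0$ or $\mathcal{L}_\infty^-\psi(x_0)+\lambda\psi(x_0)\ge0$ whenever $\psi\in C_0^1(\mathbb{R}^n)$ touches $u$ from above at $x_0\in\Omega$; a viscosity solution if both. *)

theory Defs
  imports "HOL-Analysis.Analysis"
begin

text \<open>
  The supremum and infimum are taken in the extended reals, so that both operators are meaningful
  for every function. For a compactly supported \<open>C\<^sup>1\<close> function and \<open>0 < \<alpha> \<le> 1\<close> the difference
  quotients are bounded; the convention \<open>\<infinity> + (- \<infinity>) = \<infinity>\<close> for the sum is therefore never used
  when the operators are applied to test functions.
\<close>

definition L_plus :: "real \<Rightarrow> (real ^ 'n \<Rightarrow> real) \<Rightarrow> real ^ 'n \<Rightarrow> ereal" where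
  "L_plus \<alpha> u x = (SUP y\<in>UNIV - {x}. ereal ((u y - u x) / norm (y - x) powr \<alpha>))"

definition L_minus :: "real \<Rightarrow> (real ^ 'n \<Rightarrow> real) \<Rightarrow> real ^ 'n \<Rightarrow> ereal" where
  "L_minus \<alpha> u x = (INF y\<in>UNIV - {x}. ereal ((u y - u x) / norm (y - x) powr \<alpha>))"

definition L_inf :: "real \<Rightarrow> (real ^ 'n \<Rightarrow> real) \<Rightarrow> real ^ 'n \<Rightarrow> ereal" where
  "L_inf \<alpha> u x = L_plus \<alpha> u x + L_minus \<alpha> u x"

definition C0_closure :: "(real ^ 'n) set \<Rightarrow> (real ^ 'n \<Rightarrow> real) set" where
  "C0_closure \<Omega> = {u. continuous_on (closure \<Omega>) u \<and> (\<forall>x\<in>frontier \<Omega>. u x = 0)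
                       \<and> (\<forall>x. x \<notin> closure \<Omega> \<longrightarrow> u x = 0)}"

definition C1_compact_support :: "(real ^ 'n \<Rightarrow> real) set" where
  "C1_compact_support = {\<phi>. (\<exists>D. (\<forall>x. GDERIV \<phi> x :> D x) \<and> continuous_on UNIV D)
                              \<and> compact (closure {x. \<phi> x \<noteq> 0})}"

definition touches_below :: "(real ^ 'n \<Rightarrow> real) \<Rightarrow> (real ^ 'n \<Rightarrow> real) \<Rightarrow> real ^ 'n \<Rightarrow> bool" where
  "touches_below \<phi> u x \<longleftrightarrow> \<phi> x = u x \<and> (\<forall>y. \<phi> y \<le> u y)"

definition touches_above :: "(real ^ 'n \<Rightarrow> real) \<Rightarrow> (real ^ 'n \<Rightarrow> real) \<Rightarrow> real ^ 'n \<Rightarrow> bool" where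
  "touches_above \<psi> u x \<longleftrightarrow> \<psi> x = u x \<and> (\<forall>y. \<psi> y \<ge> u y)"

definition viscosity_supersolution ::
    "real \<Rightarrow> real \<Rightarrow> (real ^ 'n) set \<Rightarrow> (real ^ 'n \<Rightarrow> real) \<Rightarrow> bool" where
  "viscosity_supersolution \<alpha> lam \<Omega> u \<longleftrightarrow>
     (\<forall>x\<in>\<Omega>. \<forall>\<phi>\<in>C1_compact_support. touches_below \<phi> u x \<longrightarrow>
        L_inf \<alpha> \<phi> x \<le> 0 \<and> L_minus \<alpha> \<phi> x + ereal (lam * \<phi> x) \<le> 0)"

definition viscosity_subsolution ::
    "real \<Rightarrow> real \<Rightarrow> (real ^ 'n) set \<Rightarrow> (real ^ 'n \<Rightarrow> real) \<Rightarrow> bool" where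
  "viscosity_subsolution \<alpha> lam \<Omega> u \<longleftrightarrow>
     (\<forall>x\<in>\<Omega>. \<forall>\<psi>\<in>C1_compact_support. touches_above \<psi> u x \<longrightarrow>
        L_inf \<alpha> \<psi> x \<ge> 0 \<or> L_minus \<alpha> \<psi> x + ereal (lam * \<psi> x) \<ge> 0)"

definition viscosity_solution ::
    "real \<Rightarrow> real \<Rightarrow> (real ^ 'n) set \<Rightarrow> (real ^ 'n \<Rightarrow> real) \<Rightarrow> bool" where
  "viscosity_solution \<alpha> lam \<Omega> u \<longleftrightarrow>
     viscosity_supersolution \<alpha> lam \<Omega> u \<and> viscosity_subsolution \<alpha> lam \<Omega> u"

definition inradius :: "(real ^ 'n) set \<Rightarrow> real" where
  "inradius \<Omega> = (SUP x\<in>\<Omega>. infdist x (- \<Omega>))"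

text \<open>For a bounded domain the supremum is a maximum, attained at a point of \<open>\<Omega>\<close>.\<close>

lemma inradius_is_max:
  fixes \<Omega> :: "(real ^ 'n) set"
  assumes "open \<Omega>" "\<Omega> \<noteq> {}" "bounded \<Omega>"
  shows "\<exists>x\<in>\<Omega>. infdist x (- \<Omega>) = inradius \<Omega> \<and> (\<forall>y\<in>\<Omega>. infdist y (- \<Omega>) \<le> infdist x (- \<Omega>))"
proof -
  let ?d = "\<lambda>x. infdist x (- \<Omega>)"
  have ne: "- \<Omega> \<noteq> {}"
    using assms(3) not_bounded_UNIV by (metis Compl_empty_eq double_complement)
  have "compact (closure \<Omega>)" using assms(3) by simp
  moreover have "closure \<Omega> \<noteq> {}" using assms(2) by simp
  moreover have "continuous_on (closure \<Omega>) ?d" by (intro continuous_intros)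
  ultimately obtain x where x: "x \<in> closure \<Omega>" "\<And>y. y \<in> closure \<Omega> \<Longrightarrow> ?d y \<le> ?d x"
    using continuous_attains_sup by meson
  obtain z where z: "z \<in> \<Omega>" using assms(2) by blast
  have cl: "closed (- \<Omega>)" using assms(1) by (simp add: closed_Compl)
  have "0 < ?d z"
    using in_closed_iff_infdist_zero[OF cl ne, of z] z infdist_nonneg[of z "- \<Omega>"] by auto
  also have "?d z \<le> ?d x" using x(2) z closure_subset by blast
  finally have xin: "x \<in> \<Omega>" by (metis ComplI infdist_zero less_irrefl)
  have max: "\<forall>y\<in>\<Omega>. ?d y \<le> ?d x" using x(2) closure_subset by blast
  have "inradius \<Omega> = ?d x"
    unfolding inradius_def by (rule cSup_eq_maximum) (use xin max in auto)
  then show ?thesis using xin max by auto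
qed

end

theory Submission imports Defs begin

text \<open>
  Positivity of \<open>u\<close> follows by placing a bump below \<open>u\<close>. The lower bound for the eigenvalue is
  the subsolution condition at a maximum point of \<open>u\<close>, tested with a function that is almost
  the maximum on \<open>\<Omega>\<close> and almost \<open>0\<close> at a nearest point of the complement.

  For the upper bound, let \<open>B(z,R) \<subseteq> \<Omega>\<close> be a largest ball and touch \<open>u\<close> from below by a multiple
  of a smoothed, strictly convexified truncation of the \<open>\<alpha>\<close>-cone
  \<open>1 - (\<bar>x - z\<bar> / R)\<^sup>\<alpha>\<close>. Away from \<open>z\<close> strict convexity makes \<open>L_inf\<close>
  positive, so the contact point is near \<open>z\<close>, and there \<open>L_minus\<close> is about \<open>- R\<^sup>-\<^sup>\<alpha>\<close> times
  the value of the test function.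
\<close>

section \<open>The operators\<close>

lemma L_plus_ge:
  "y \<noteq> x \<Longrightarrow> ereal ((\<phi> y - \<phi> x) / norm (y - x) powr \<alpha>) \<le> L_plus \<alpha> \<phi> x"
  unfolding L_plus_def by (rule SUP_upper) auto

lemma L_minus_le:
  "y \<noteq> x \<Longrightarrow> L_minus \<alpha> \<phi> x \<le> ereal ((\<phi> y - \<phi> x) / norm (y - x) powr \<alpha>)"
  unfolding L_minus_def by (rule INF_lower) auto

lemma L_plus_le:
  assumes "\<And>y. y \<noteq> x \<Longrightarrow> \<phi> y - \<phi> x \<le> b * norm (y - x) powr \<alpha>"
  shows "L_plus \<alpha> \<phi> x \<le> ereal b"
  unfolding L_plus_def
  by (rule SUP_least) (use assms in \<open>auto simp: divide_le_eq\<close>)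

lemma L_minus_ge:
  assumes "\<And>y. y \<noteq> x \<Longrightarrow> b * norm (y - x) powr \<alpha> \<le> \<phi> y - \<phi> x"
  shows "ereal b \<le> L_minus \<alpha> \<phi> x"
  unfolding L_minus_def
  by (rule INF_greatest) (use assms in \<open>auto simp: le_divide_eq\<close>)

section \<open>Radial test functions\<close>

text \<open>The condition \<open>F' 0 = 0\<close> makes the constant branch and the branch of
  \<open>F\<close> agree to first order at 0. This is what keeps truncations by \<open>max 0\<close>
  differentiable.\<close>

lemma DERIV_compose_pos_part:
  fixes F :: "real \<Rightarrow> real"
  assumes F: "\<And>t. 0 \<le> t \<Longrightarrow> (F has_real_derivative F' t) (at t)" and F0: "F' 0 = 0"
  shows "((\<lambda>t. F (max 0 t)) has_real_derivative F' (max 0 t)) (at t)"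
proof -
  consider "t > 0" | "t < 0" | "t = 0" by linarith
  then show ?thesis
  proof cases
    case 1
    have "\<forall>\<^sub>F s in nhds t. F (max 0 s) = F s"
      using eventually_nhds_in_open[of "{0<..}" t] 1 by (auto elim!: eventually_mono)
    then show ?thesis using F[of t] 1 by (subst DERIV_cong_ev[OF refl _ refl]) auto
  next
    case 2
    have "\<forall>\<^sub>F s in nhds t. F (max 0 s) = F 0"
      using eventually_nhds_in_open[of "{..<0}" t] 2 by (auto elim!: eventually_mono)
    then show ?thesis using F0 2 by (subst DERIV_cong_ev[OF refl _ refl]) auto
  next
    case 3
    have lim: "(\<lambda>h. (F h - F 0) / h) \<midarrow>0\<rightarrow> 0" using F[of 0] F0 by (simp add: DERIV_def)
    \<comment> \<open>For \<open>h < 0\<close> the truncated quotient is 0, otherwise it is that of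
      \<open>F\<close>.\<close>
    have "norm ((F (max 0 h) - F 0) / h) \<le> \<bar>(F h - F 0) / h\<bar>" for h
      by (cases "0 \<le> h") (simp_all add: max_def del: abs_divide)
    then have "(\<lambda>h. (F (max 0 h) - F 0) / h) \<midarrow>0\<rightarrow> 0"
      by (intro Lim_null_comparison[OF _ tendsto_rabs_zero[OF lim]] always_eventually) blast
    then show ?thesis using 3 F0 by (simp add: DERIV_def)
  qed
qed

text \<open>Unlike the norm, its square is smooth at the centre too. So the profile is a function of
  t = |x - c|^2, and the chain rule gives the gradient 2 g'(t) (x - c) without a
  singularity.\<close>

lemma radial_C1_compact_support:
  fixes c :: "real ^ 'n" and g :: "real \<Rightarrow> real"
  assumes g: "\<And>t. 0 \<le> t \<Longrightarrow> (g has_real_derivative g' t) (at t)"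
    and g': "continuous_on {0..} g'"
    and supp: "\<And>t. B \<le> t \<Longrightarrow> g t = 0"
  shows "(\<lambda>x. g ((norm (x - c))\<^sup>2)) \<in> C1_compact_support"
proof -
  let ?D = "\<lambda>x. (2 * g' ((norm (x - c))\<^sup>2)) *\<^sub>R (x - c)"
  have "GDERIV (\<lambda>x. g ((norm (x - c))\<^sup>2)) x :> ?D x" for x
  proof -
    have "((\<lambda>x. (x - c) \<bullet> (x - c)) has_derivative (\<lambda>h. 2 * ((x - c) \<bullet> h))) (at x)"
      by (auto intro!: derivative_eq_intros simp: inner_commute)
    then have d: "((\<lambda>x. (norm (x - c))\<^sup>2) has_derivative (\<lambda>h. 2 * ((x - c) \<bullet> h))) (at x)"
      by (simp add: power2_norm_eq_inner)
    have "(g has_derivative (*) (g' ((norm (x - c))\<^sup>2))) (at ((norm (x - c))\<^sup>2))"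
      using g[of "(norm (x - c))\<^sup>2"] by (simp add: has_field_derivative_def)
    from has_derivative_compose[OF d this] show ?thesis
      by (simp add: gderiv_def inner_commute mult.left_commute mult.assoc)
  qed
  moreover have "continuous_on UNIV ?D"
    by (intro continuous_intros continuous_on_compose2[OF g']) auto
  moreover have "bounded {x. g ((norm (x - c))\<^sup>2) \<noteq> 0}"
  \<comment> \<open>\<open>B\<close> may be negative, hence the absolute value.\<close>
  proof (rule bounded_subset[OF bounded_cball[of c "sqrt \<bar>B\<bar>"]], clarsimp)
    fix x assume "g ((norm (x - c))\<^sup>2) \<noteq> 0"
    then have "(norm (x - c))\<^sup>2 \<le> \<bar>B\<bar>" 
      using supp[of "(norm (x - c))\<^sup>2"] by (cases "B \<le> (norm (x - c))\<^sup>2") auto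
    then show "dist c x \<le> sqrt \<bar>B\<bar>" by (simp add: real_le_rsqrt dist_norm norm_minus_commute)
  qed
  ultimately show ?thesis
    unfolding C1_compact_support_def
    by (intro CollectI conjI exI[of _ ?D]) (auto simp: compact_closure)
qed

lemma C1_compact_support_lincomb:
  fixes f g :: "real ^ 'n \<Rightarrow> real"
  assumes "f \<in> C1_compact_support" "g \<in> C1_compact_support"
  shows "(\<lambda>x. a * f x + b * g x) \<in> C1_compact_support"
proof -
  obtain D E where D: "\<And>x. GDERIV f x :> D x" "continuous_on UNIV D"
    and E: "\<And>x. GDERIV g x :> E x" "continuous_on UNIV E"
    using assms unfolding C1_compact_support_def by blast
  have "GDERIV (\<lambda>x. a * f x + b * g x) x :> a *\<^sub>R D x + b *\<^sub>R E x" for x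
    using D(1)[of x] E(1)[of x] unfolding gderiv_def
    by (auto intro!: derivative_eq_intros simp: inner_add_right)
  moreover have "continuous_on UNIV (\<lambda>x. a *\<^sub>R D x + b *\<^sub>R E x)"
    by (intro continuous_intros D E)
  moreover have "bounded {x. a * f x + b * g x \<noteq> 0}"
    by (rule bounded_subset[of "{x. f x \<noteq> 0} \<union> {x. g x \<noteq> 0}"])
      (use assms in \<open>auto simp: C1_compact_support_def compact_closure\<close>)
  ultimately show ?thesis
    unfolding C1_compact_support_def
    by (intro CollectI conjI exI[of _ "\<lambda>x. a *\<^sub>R D x + b *\<^sub>R E x"]) (auto simp: compact_closure)
qed

lemma C1_compact_support_cmult:
  fixes f :: "real ^ 'n \<Rightarrow> real"
  assumes "f \<in> C1_compact_support"
  shows "(\<lambda>x. a * f x) \<in> C1_compact_support"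
  using C1_compact_support_lincomb[OF assms assms, of a 0] by simp

section \<open>Cutoff functions: bumps and plateaus\<close>

lemma DERIV_pos_part_square:
  "((\<lambda>t::real. (max 0 t)\<^sup>2) has_real_derivative 2 * max 0 t) (at t)"
  by (rule DERIV_compose_pos_part[of "\<lambda>t. t\<^sup>2" "\<lambda>t. 2 * t"])
    (auto intro!: derivative_eq_intros)

text \<open>Two nested squared positive parts give a C^1 transition from 1 on t \<le> 0 to 0 on t
  \<ge> 1.\<close>

definition cutoff :: "real \<Rightarrow> real" where
  "cutoff t = (max 0 (1 - (max 0 t)\<^sup>2))\<^sup>2"

lemma cutoff_le: "t \<le> 0 \<Longrightarrow> cutoff t = 1" by (simp add: cutoff_def max_def)

lemma cutoff_ge:
  assumes "1 \<le> t"
  shows "cutoff t = 0"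
proof -
  have "1 - (max 0 t)\<^sup>2 \<le> 0" using one_le_power[of t 2] assms by simp
  then show ?thesis by (simp add: cutoff_def)
qed

lemma cutoff_bounds: "0 \<le> cutoff t" "cutoff t \<le> 1"
  by (auto simp: cutoff_def power_le_one)

lemma DERIV_cutoff:
  "(cutoff has_real_derivative - 4 * max 0 (1 - (max 0 t)\<^sup>2) * max 0 t) (at t)"
  unfolding cutoff_def[abs_def]
  by (rule DERIV_cong[OF DERIV_chain2[OF DERIV_pos_part_square
        DERIV_diff[OF DERIV_const DERIV_pos_part_square]]]) simp

text \<open>The transition takes place where |x - c|^2 lies between \<open>a\<close> and
  \<open>a + b\<close>: \<open>a = 0\<close> will give a bump, a large \<open>a\<close> a
  plateau.\<close>

lemma radial_cutoff:
  fixes c :: "real ^ 'n"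
  assumes "0 < b"
  shows "(\<lambda>x. cutoff (((norm (x - c))\<^sup>2 - a) / b)) \<in> C1_compact_support"
proof (rule radial_C1_compact_support[where B = "a + b"])
  fix t :: real
  let ?g' = "\<lambda>t. - 4 * max 0 (1 - (max 0 ((t - a) / b))\<^sup>2) * max 0 ((t - a) / b) * (1 / b)"
  show "((\<lambda>t. cutoff ((t - a) / b)) has_real_derivative ?g' t) (at t)"
    by (rule DERIV_chain2[OF DERIV_cutoff]) (use assms in \<open>auto intro!: derivative_eq_intros\<close>)
  show "continuous_on {0..} ?g'" using assms by (intro continuous_intros) auto
  show "cutoff ((t - a) / b) = 0" if "a + b \<le> t"
    by (rule cutoff_ge) (use that assms in \<open>auto simp: le_divide_eq\<close>)
qed

lemma bump_C1:
  fixes c :: "real ^ 'n"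
  assumes "0 < r"
  obtains \<beta> where "\<beta> \<in> C1_compact_support" "\<beta> c = 1" "\<And>x. 0 \<le> \<beta> x" "\<And>x. \<beta> x \<le> 1"
    "\<And>x. r \<le> dist x c \<Longrightarrow> \<beta> x = 0"
proof
  let ?b = "\<lambda>x. cutoff (((norm (x - c))\<^sup>2 - 0) / r\<^sup>2)"
  show "?b \<in> C1_compact_support" by (rule radial_cutoff) (use assms in simp)
  show "?b c = 1" by (simp add: cutoff_le)
  show "0 \<le> ?b x" "?b x \<le> 1" for x by (rule cutoff_bounds)+
  show "?b x = 0" if "r \<le> dist x c" for x
    by (rule cutoff_ge) (use that assms power_mono[of r "dist x c" 2] in \<open>auto simp: dist_norm\<close>)
qed

lemma plateau_C1:
  fixes S :: "(real ^ 'n) set"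
  assumes "bounded S"
  obtains \<beta> where "\<beta> \<in> C1_compact_support" "\<And>x. x \<in> S \<Longrightarrow> \<beta> x = 1" "\<And>x. 0 \<le> \<beta> x" "\<And>x. \<beta> x \<le> 1"
proof -
  obtain B where B: "\<And>x. x \<in> S \<Longrightarrow> norm x \<le> B" using assms by (auto simp: bounded_iff)
  let ?b = "\<lambda>x. cutoff (((norm (x - 0))\<^sup>2 - B\<^sup>2) / 1)"
  show ?thesis
  proof
    show "?b \<in> C1_compact_support" by (rule radial_cutoff) simp
    show "?b x = 1" if "x \<in> S" for x
      by (rule cutoff_le) (use B[OF that] power_mono[of "norm x" B 2] in auto)
    show "0 \<le> ?b x" "?b x \<le> 1" for x by (rule cutoff_bounds)+
  qed
qed

section \<open>Positivity and the lower bound\<close>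

lemma C0_closure_zero: "u \<in> C0_closure \<Omega> \<Longrightarrow> open \<Omega> \<Longrightarrow> x \<notin> \<Omega> \<Longrightarrow> u x = 0"
  by (auto simp: C0_closure_def frontier_def interior_open)

text \<open>Pasting along two closed sets, the closure of \<Omega> and the complement of \<Omega>;
  on the latter \<open>u\<close> vanishes.\<close>

lemma C0_closure_continuous:
  assumes "u \<in> C0_closure \<Omega>" "open \<Omega>"
  shows "continuous_on UNIV u"
proof -
  have "continuous_on (- \<Omega>) u"
    by (rule continuous_on_eq[of _ "\<lambda>_. 0"]) (auto simp: C0_closure_zero[OF assms])
  then have "continuous_on (closure \<Omega> \<union> - \<Omega>) u"
    using assms by (intro continuous_on_closed_Un) (auto simp: C0_closure_def)
  moreover have "closure \<Omega> \<union> - \<Omega> = UNIV" using closure_subset[of \<Omega>] by blast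
  ultimately show ?thesis by simp
qed

text \<open>The operator sees all of space: at a zero \<open>x\<close> of \<open>u\<close>, a bump
  below \<open>u\<close> around \<open>y\<close> touches from below with value 0. Its lower operator
  at \<open>x\<close> is at least 0 and its upper one is positive, against \<open>L_inf\<close>
  \<le> 0.\<close>

lemma supersolution_pos:
  fixes u :: "real ^ 'n \<Rightarrow> real"
  assumes cont: "continuous_on UNIV u" and nonneg: "\<And>x. 0 \<le> u x" and y: "u y \<noteq> 0"
    and sup: "viscosity_supersolution \<alpha> lam \<Omega> u" and x: "x \<in> \<Omega>"
  shows "0 < u x"
proof (rule ccontr)
  assume "\<not> 0 < u x"
  then have ux: "u x = 0" using nonneg[of x] by simp
  have uy: "0 < u y" using nonneg[of y] y by simp
  obtain r where r: "0 < r" "\<And>w. dist w y < r \<Longrightarrow> dist (u w) (u y) < u y / 2"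
    using cont uy unfolding continuous_on_iff by (force dest: spec[of _ "u y / 2"])
  obtain \<beta> where \<beta>: "\<beta> \<in> C1_compact_support" "\<beta> y = 1" "\<And>w. 0 \<le> \<beta> w" "\<And>w. \<beta> w \<le> 1"
    "\<And>w. r \<le> dist w y \<Longrightarrow> \<beta> w = 0"
    using bump_C1[OF r(1)] by metis
  let ?\<phi> = "\<lambda>w. (u y / 2) * \<beta> w"
  have le: "?\<phi> w \<le> u w" for w
  proof (cases "dist w y < r")
    case True
    then have "u y / 2 \<le> u w" using r(2)[of w] by (auto simp: dist_real_def abs_if split: if_splits)
    moreover have "u y / 2 * \<beta> w \<le> u y / 2 * 1" by (rule mult_left_mono) (use \<beta> uy in auto)
    ultimately show ?thesis by simp
  qed (use \<beta> nonneg in auto)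
  have \<phi>x: "?\<phi> x = 0" using le[of x] ux \<beta>(3)[of x] uy by (simp add: mult_le_0_iff antisym)
  have "?\<phi> \<in> C1_compact_support" by (rule C1_compact_support_cmult[OF \<beta>(1)])
  moreover have "touches_below ?\<phi> u x" using le \<phi>x ux by (simp add: touches_below_def)
  ultimately have "L_inf \<alpha> ?\<phi> x \<le> 0"
    using sup x unfolding viscosity_supersolution_def by blast
  moreover have "ereal 0 \<le> L_minus \<alpha> ?\<phi> x"
    by (rule L_minus_ge) (use \<phi>x \<beta> uy in auto)
  moreover have yx: "y \<noteq> x" using ux y by blast
  have "ereal ((?\<phi> y - ?\<phi> x) / norm (y - x) powr \<alpha>) \<le> L_plus \<alpha> ?\<phi> x"
    by (rule L_plus_ge[OF yx])
  ultimately have "ereal ((?\<phi> y - ?\<phi> x) / norm (y - x) powr \<alpha>) + ereal 0 \<le> 0"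
    unfolding L_inf_def by (meson add_mono order_trans)
  moreover have "0 < (?\<phi> y - ?\<phi> x) / norm (y - x) powr \<alpha>"
    using \<phi>x \<beta>(2) uy yx by simp
  ultimately show False by simp
qed

text \<open>The test function is the constant \<open>u x\<close> near \<Omega> with a dip to
  \<open>e\<close> at \<open>y\<close>. At \<open>x\<close> its increments are never positive, and
  the quotient towards \<open>y\<close> bounds \<open>L_minus\<close>; then \<open>e\<close> tends
  to 0.\<close>

lemma subsolution_at_max:
  fixes u :: "real ^ 'n \<Rightarrow> real"
  assumes cont: "continuous_on UNIV u" and "bounded \<Omega>" and zero: "\<And>w. w \<notin> \<Omega> \<Longrightarrow> u w = 0"
    and sub: "viscosity_subsolution \<alpha> lam \<Omega> u"
    and x: "x \<in> \<Omega>" "\<And>w. u w \<le> u x" "0 < u x" and y: "u y = 0"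
  shows "norm (y - x) powr (- \<alpha>) \<le> lam"
proof -
  have xy: "y \<noteq> x" using x y by auto
  have key: "(u x - e) * norm (y - x) powr (- \<alpha>) \<le> lam * u x" if e: "0 < e" "e < u x" for e
  proof -
    obtain r where r: "0 < r" "\<And>w. dist w y < r \<Longrightarrow> dist (u w) (u y) < e"
      using cont e unfolding continuous_on_iff by blast
    obtain \<beta> where \<beta>: "\<beta> \<in> C1_compact_support" "\<beta> y = 1" "\<And>w. 0 \<le> \<beta> w" "\<And>w. \<beta> w \<le> 1"
      "\<And>w. r \<le> dist w y \<Longrightarrow> \<beta> w = 0"
      using bump_C1[OF r(1)] by metis
    \<comment> \<open>The plateau covers the ball around \<open>y\<close> as well, so that the test
      function stays above \<open>e\<close>, hence above \<open>u\<close>, inside the dip.\<close>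
    obtain \<eta> where \<eta>: "\<eta> \<in> C1_compact_support" "\<And>w. w \<in> insert y (\<Omega> \<union> ball y r) \<Longrightarrow> \<eta> w = 1"
      "\<And>w. 0 \<le> \<eta> w" "\<And>w. \<eta> w \<le> 1"
      using plateau_C1[of "insert y (\<Omega> \<union> ball y r)"] \<open>bounded \<Omega>\<close> by (metis bounded_Un bounded_ball bounded_insert)
    let ?\<psi> = "\<lambda>w. u x * \<eta> w + (- (u x - e)) * \<beta> w"
    have le: "?\<psi> w \<le> u x" for w
    proof -
      have "u x * \<eta> w \<le> u x * 1" by (rule mult_left_mono) (use \<eta> x in auto)
      moreover have "0 \<le> (u x - e) * \<beta> w" using \<beta> e by simp
      ultimately show ?thesis by linarith
    qed
    have ge: "u w \<le> ?\<psi> w" for w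
    proof (cases "dist w y < r")
      case True
      have "(u x - e) * \<beta> w \<le> (u x - e) * 1" by (rule mult_left_mono) (use \<beta> e in auto)
      moreover have "u w < e" using r(2)[OF True] y by (simp add: dist_real_def)
      moreover have "\<eta> w = 1" using True by (intro \<eta>) (auto simp: dist_commute)
      ultimately show ?thesis by (simp add: algebra_simps)
    next
      case False
      then have "\<beta> w = 0" using \<beta> by simp
      then show ?thesis using x \<eta>(2)[of w] \<eta>(3)[of w] zero[of w] by (cases "w \<in> \<Omega>") auto
    qed
    have \<psi>x: "?\<psi> x = u x" using le[of x] ge[of x] by simp
    have \<psi>y: "?\<psi> y = e" using \<beta> \<eta>(2)[of y] by simp
    let ?k = "(u x - e) * norm (y - x) powr (- \<alpha>)"
    have k: "0 < ?k" using e xy by simp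
    have "L_minus \<alpha> ?\<psi> x \<le> ereal ((?\<psi> y - ?\<psi> x) / norm (y - x) powr \<alpha>)"
      by (rule L_minus_le[OF xy])
    also have "(?\<psi> y - ?\<psi> x) / norm (y - x) powr \<alpha> = - ?k"
      unfolding \<psi>x \<psi>y powr_minus_divide
      using minus_divide_left[of "u x - e" "norm (y - x) powr \<alpha>"] by simp
    finally have m: "L_minus \<alpha> ?\<psi> x \<le> ereal (- ?k)" .
    have p: "L_plus \<alpha> ?\<psi> x \<le> ereal 0" by (rule L_plus_le) (use le \<psi>x in auto)
    have "L_inf \<alpha> ?\<psi> x \<le> ereal 0 + ereal (- ?k)"
      unfolding L_inf_def by (rule add_mono[OF p m])
    \<comment> \<open>This excludes the first alternative of the subsolution condition, leaving the
      one that contains \<open>lam\<close>.\<close>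
    then have neg: "L_inf \<alpha> ?\<psi> x < 0" using k by (simp add: order_le_less_trans)
    have "?\<psi> \<in> C1_compact_support" by (rule C1_compact_support_lincomb[OF \<eta>(1) \<beta>(1)])
    moreover have "touches_above ?\<psi> u x" using ge \<psi>x by (simp add: touches_above_def)
    ultimately have "L_inf \<alpha> ?\<psi> x \<ge> 0 \<or> L_minus \<alpha> ?\<psi> x + ereal (lam * ?\<psi> x) \<ge> 0"
      using sub x(1) unfolding viscosity_subsolution_def by blast
    with neg have "0 \<le> L_minus \<alpha> ?\<psi> x + ereal (lam * ?\<psi> x)" by auto
    also have "\<dots> \<le> ereal (- ?k) + ereal (lam * ?\<psi> x)" by (intro add_mono m order_refl)
    finally show ?thesis unfolding \<psi>x by simp
  qed
  have "((\<lambda>e. (u x - e) * norm (y - x) powr (- \<alpha>)) \<longlongrightarrow> (u x - 0) * norm (y - x) powr (- \<alpha>)) (at_right 0)"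
    by (intro tendsto_intros)
  moreover have "\<forall>\<^sub>F e in at_right 0. (u x - e) * norm (y - x) powr (- \<alpha>) \<le> lam * u x"
    using eventually_at_right_less[of "0::real"] eventually_at_right_real[OF x(3)]
    by eventually_elim (use key in auto)
  ultimately have "(u x - 0) * norm (y - x) powr (- \<alpha>) \<le> lam * u x"
    by (rule tendsto_upperbound) simp
  then show ?thesis using x(3) by (simp add: mult.commute)
qed

section \<open>The upper bound\<close>

text \<open>After division by \<open>b + c\<close> this reduces to t \<le> t^\<alpha> on [0,1],
  applied to two numbers with sum 1.\<close>

lemma powr_le_powr_add:
  fixes a b c \<alpha> :: real
  assumes "0 \<le> a" "0 \<le> b" "0 \<le> c" "a \<le> b + c" "0 < \<alpha>" "\<alpha> \<le> 1"
  shows "a powr \<alpha> \<le> b powr \<alpha> + c powr \<alpha>"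
proof (cases "b + c = 0")
  case False
  define s where "s = b + c"
  have s: "0 < s" using False assms s_def by simp
  have *: "t / s \<le> (t / s) powr \<alpha>" if "0 \<le> t" "t \<le> s" for t
    using powr_mono'[of \<alpha> 1 "t / s"] that s assms by (simp add: divide_le_eq)
  have "1 = b / s + c / s" using s by (simp add: s_def add_divide_distrib[symmetric])
  also have "\<dots> \<le> (b / s) powr \<alpha> + (c / s) powr \<alpha>"
    by (intro add_mono *) (use assms s_def in auto)
  also have "\<dots> = (b powr \<alpha> + c powr \<alpha>) / s powr \<alpha>"
    using assms s by (simp add: powr_divide add_divide_distrib)
  finally have "s powr \<alpha> \<le> b powr \<alpha> + c powr \<alpha>" using s by (simp add: le_divide_eq)
  moreover have "a powr \<alpha> \<le> s powr \<alpha>" using assms s_def by (intro powr_mono2) auto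
  ultimately show ?thesis by simp
qed (use assms in auto)

section \<open>The strictly convex profile and its parameters\<close>

text \<open>
  A perturbation of the identity on \<open>v \<ge> 0\<close>: the double zero at \<open>0\<close> makes its composition with
  \<open>max 0\<close> a \<open>C\<^sup>1\<close> function, and \<open>v\<^sup>2 / (v + \<epsilon>) = v - \<epsilon> + \<epsilon>\<^sup>2 / (v + \<epsilon>)\<close> shows strict convexity.
\<close>

definition conv :: "real \<Rightarrow> real \<Rightarrow> real" where
  "conv \<epsilon> v = v\<^sup>2 / (v + \<epsilon>)"

definition conv' :: "real \<Rightarrow> real \<Rightarrow> real" where
  "conv' \<epsilon> v = v * (v + 2 * \<epsilon>) / (v + \<epsilon>)\<^sup>2"

lemma DERIV_conv: "0 < \<epsilon> \<Longrightarrow> 0 \<le> v \<Longrightarrow> (conv \<epsilon> has_real_derivative conv' \<epsilon> v) (at v)"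
  unfolding conv_def[abs_def] conv'_def
  by (rule derivative_eq_intros refl | simp)+ (simp add: field_simps power2_eq_square)

text \<open>The affine part of \<open>conv\<close> drops out; what remains is \<epsilon>^2 times the
  tangent gap of 1/b, namely (b - a)^2 / (a^2 b), at a = v + \<epsilon> and b = w + \<epsilon>. The
  exact form makes strict convexity quantitative.\<close>

lemma conv_tangent_gap:
  assumes "0 < \<epsilon>" "0 \<le> v" "0 \<le> w"
  shows "conv \<epsilon> w - conv \<epsilon> v - conv' \<epsilon> v * (w - v) = \<epsilon>\<^sup>2 * (w - v)\<^sup>2 / ((v + \<epsilon>)\<^sup>2 * (w + \<epsilon>))"
proof -
  have "(b - \<epsilon>)\<^sup>2 / b - (a - \<epsilon>)\<^sup>2 / a - (a - \<epsilon>) * (a + \<epsilon>) / a\<^sup>2 * (b - a)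
      = \<epsilon>\<^sup>2 * (b - a)\<^sup>2 / (a\<^sup>2 * b)" if "a \<noteq> 0" "b \<noteq> 0" for a b
    using that by (simp add: field_simps power2_eq_square)
  from this[of "v + \<epsilon>" "w + \<epsilon>"] show ?thesis
    using assms by (simp add: conv_def conv'_def add.assoc)
qed

lemma conv_above_tangent:
  assumes "0 < \<epsilon>" "0 \<le> v" "0 \<le> w"
  shows "conv' \<epsilon> v * (w - v) \<le> conv \<epsilon> w - conv \<epsilon> v"
proof -
  have "0 \<le> \<epsilon>\<^sup>2 * (w - v)\<^sup>2 / ((v + \<epsilon>)\<^sup>2 * (w + \<epsilon>))" using assms by simp
  then show ?thesis using conv_tangent_gap[OF assms] by linarith
qed

lemma conv'_bounds:
  assumes "0 < \<epsilon>" "0 \<le> v"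
  shows "0 \<le> conv' \<epsilon> v" "conv' \<epsilon> v \<le> 1"
proof -
  have "v * (v + 2 * \<epsilon>) \<le> (v + \<epsilon>)\<^sup>2" by (simp add: power2_eq_square algebra_simps)
  then show "conv' \<epsilon> v \<le> 1" using assms by (simp add: conv'_def)
qed (use assms in \<open>simp add: conv'_def\<close>)

text \<open>
  The first inequality will express \<open>L_minus \<phi> + \<lambda>\<phi> \<le> 0\<close> and the second one \<open>L_inf \<phi> \<le> 0\<close> at the
  contact point. The first keeps \<open>v\<close> away from \<open>1\<close>, the second forces it close to \<open>1\<close>.
\<close>

lemma conv_parameters:
  assumes "1 < \<kappa>"
  obtains \<epsilon> \<eta> where "0 < \<epsilon>" "0 < \<eta>" "\<eta> < 1"
    "\<And>v. 0 < v \<Longrightarrow> v \<le> 1 \<Longrightarrow> \<kappa> * conv \<epsilon> v \<le> conv' \<epsilon> v \<Longrightarrow>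
        conv \<epsilon> (1 - \<eta>) - conv \<epsilon> v \<le> conv' \<epsilon> v * (1 - v) \<Longrightarrow> False"
proof -
  \<comment> \<open>With this choice \<kappa> \<open>conv\<close> equals 1 at v = 1, while
    \<open>conv'\<close> is below 1 there: the first inequality fails at v = 1.\<close>
  define \<epsilon> where "\<epsilon> = \<kappa> - 1"
  have \<epsilon>: "0 < \<epsilon>" "\<kappa> = 1 + \<epsilon>" using assms by (auto simp: \<epsilon>_def)
  \<comment> \<open>The distance from 1 that the first inequality forces on
    \<open>v\<close>.\<close>
  define d where "d = \<epsilon>\<^sup>2 / ((1 + \<epsilon>) * (2 + \<epsilon>))"
  have d: "0 < d" using \<epsilon> by (simp add: d_def)
  \<comment> \<open>A lower bound for the tangent gap from \<open>v\<close> to 1 once 1 - v \<ge> d.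
    Since \<open>conv\<close> has slope at most 1, shifting 1 to 1 - \<eta> with \<eta> < q cannot
    close that gap.\<close>
  define q where "q = \<epsilon>\<^sup>2 * d\<^sup>2 / ((1 + \<epsilon>)\<^sup>2 * (1 + \<epsilon>))"
  have q: "0 < q" using \<epsilon> d by (simp add: q_def)
  define \<eta> where "\<eta> = min (1/2) (q / 2)"
  have \<eta>: "0 < \<eta>" "\<eta> < 1" "\<eta> < q" using q by (auto simp: \<eta>_def)
  have False if v: "0 < v" "v \<le> 1" and 1: "\<kappa> * conv \<epsilon> v \<le> conv' \<epsilon> v"
    and 2: "conv \<epsilon> (1 - \<eta>) - conv \<epsilon> v \<le> conv' \<epsilon> v * (1 - v)" for v
  proof -
    have p: "0 < v + \<epsilon>" using v \<epsilon> by simp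
    have "\<kappa> * conv \<epsilon> v * ((v + \<epsilon>)\<^sup>2 / v) \<le> conv' \<epsilon> v * ((v + \<epsilon>)\<^sup>2 / v)"
      by (rule mult_right_mono[OF 1]) (use v in simp)
    also have "conv' \<epsilon> v * ((v + \<epsilon>)\<^sup>2 / v) = v + 2 * \<epsilon>"
      using v p by (simp add: conv'_def)
    also have "\<kappa> * conv \<epsilon> v * ((v + \<epsilon>)\<^sup>2 / v) = (1 + \<epsilon>) * v * (v + \<epsilon>)"
    proof -
      have "v\<^sup>2 / a * (a\<^sup>2 / v) = v * a" if "a \<noteq> 0" for a
        using that v by (simp add: field_simps power2_eq_square)
      from this[of "v + \<epsilon>"] have "conv \<epsilon> v * ((v + \<epsilon>)\<^sup>2 / v) = v * (v + \<epsilon>)"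
        unfolding conv_def using p by (metis less_irrefl)
      then show ?thesis by (simp only: \<epsilon>(2) mult.assoc)
    qed
    finally have "(1 + \<epsilon>) * v * (v + \<epsilon>) \<le> v + 2 * \<epsilon>" .
    \<comment> \<open>Taylor expansion of the quadratic inequality around v = 1.\<close>
    moreover have "(1 + \<epsilon>) * (2 + \<epsilon>) * (1 - v) - \<epsilon>\<^sup>2 - (v + 2 * \<epsilon> - (1 + \<epsilon>) * v * (v + \<epsilon>))
        = (1 - v) + (1 + \<epsilon>) * (1 - v)\<^sup>2"
      by (simp add: power2_eq_square algebra_simps)
    moreover have "0 \<le> (1 - v) + (1 + \<epsilon>) * (1 - v)\<^sup>2" using v \<epsilon> by simp
    ultimately have "\<epsilon>\<^sup>2 \<le> (1 + \<epsilon>) * (2 + \<epsilon>) * (1 - v)" by linarith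
    then have dv: "d \<le> 1 - v" using \<epsilon> by (simp add: d_def divide_le_eq mult.commute)
    have "q \<le> \<epsilon>\<^sup>2 * (1 - v)\<^sup>2 / ((v + \<epsilon>)\<^sup>2 * (1 + \<epsilon>))"
      unfolding q_def
      by (intro frac_le mult_mono power_mono) (use dv d v \<epsilon> in auto)
    also have "\<dots> = conv \<epsilon> 1 - conv \<epsilon> v - conv' \<epsilon> v * (1 - v)"
      using conv_tangent_gap[of \<epsilon> v 1] v \<epsilon> by simp
    also have "\<dots> \<le> conv \<epsilon> 1 - conv \<epsilon> (1 - \<eta>)" using 2 by simp
    also have "\<dots> \<le> conv' \<epsilon> 1 * \<eta>"
      using conv_above_tangent[of \<epsilon> 1 "1 - \<eta>"] \<epsilon> \<eta> by simp
    also have "\<dots> \<le> \<eta>" using mult_right_mono[OF conv'_bounds(2)[of \<epsilon> 1], of \<eta>] \<epsilon> \<eta> by simp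
    finally show False using \<eta> by simp
  qed
  then show ?thesis using that \<epsilon> \<eta> by blast
qed

text \<open>The norm of the pair is sqrt(|x - z|^2 + \<delta>^2), which rounds off the tip of the
  cone; the double zero of \<open>conv\<close> smooths the edge where the cone is truncated.\<close>

lemma smoothed_cone_C1:
  fixes z :: "real ^ 'n" and \<delta> :: real
  assumes "0 < \<epsilon>" "0 < \<alpha>" "0 < R" "0 < \<delta>"
  shows "(\<lambda>x. conv \<epsilon> (max 0 (1 - norm (x - z, \<delta>) powr \<alpha> / R powr \<alpha>))) \<in> C1_compact_support"
proof -
  let ?v = "\<lambda>t. 1 - (t + \<delta>\<^sup>2) powr (\<alpha> / 2) / R powr \<alpha>"
  let ?v' = "\<lambda>t. - ((\<alpha> / 2) * (t + \<delta>\<^sup>2) powr (\<alpha> / 2 - 1) / R powr \<alpha>)"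
  have pos: "0 < t + \<delta>\<^sup>2" if "0 \<le> t" for t using that assms(4) by (simp add: add_nonneg_pos)
  have "(\<lambda>x. conv \<epsilon> (max 0 (?v ((norm (x - z))\<^sup>2)))) \<in> C1_compact_support"
  proof (rule radial_C1_compact_support[where B = "R\<^sup>2"])
    fix t :: real assume t: "0 \<le> t"
    have v: "(?v has_real_derivative ?v' t) (at t)"
      using pos[OF t] assms by (auto intro!: derivative_eq_intros)
    have "((\<lambda>v. conv \<epsilon> (max 0 v)) has_real_derivative conv' \<epsilon> (max 0 v)) (at v)" for v
      by (rule DERIV_compose_pos_part[OF DERIV_conv]) (use assms in \<open>auto simp: conv'_def\<close>)
    from DERIV_chain2[OF this v]
    show "((\<lambda>t. conv \<epsilon> (max 0 (?v t))) has_real_derivative conv' \<epsilon> (max 0 (?v t)) * ?v' t) (at t)" .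
  next
    show "continuous_on {0..} (\<lambda>t. conv' \<epsilon> (max 0 (?v t)) * ?v' t)"
      unfolding conv'_def using assms pos
      by (intro continuous_intros) (auto simp: add_nonneg_eq_0_iff max_def)
  next
    fix t :: real assume t: "R\<^sup>2 \<le> t"
    have "R powr \<alpha> = (R\<^sup>2) powr (\<alpha> / 2)"
      using assms by (simp add: powr_powr flip: powr_numeral)
    also have "\<dots> \<le> (t + \<delta>\<^sup>2) powr (\<alpha> / 2)"
      by (rule powr_mono2) (use t assms in \<open>auto intro: add_increasing2\<close>)
    finally have "?v t \<le> 0" using assms by (simp add: le_divide_eq)
    then show "conv \<epsilon> (max 0 (?v t)) = 0" by (simp add: conv_def max_def)
  qed
  moreover have "norm (x - z, \<delta>) powr \<alpha> = ((norm (x - z))\<^sup>2 + \<delta>\<^sup>2) powr (\<alpha> / 2)" for x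
  proof -
    have "0 < (norm (x - z))\<^sup>2 + \<delta>\<^sup>2" by (rule pos) simp
    then show ?thesis by (simp add: norm_Pair powr_powr flip: powr_half_sqrt)
  qed
  ultimately show ?thesis by simp
qed

text \<open>If \<open>lam\<close> were larger, a multiple of the smoothed cone would touch
  \<open>u\<close> from below. At the contact point the two supersolution inequalities become the
  two incompatible ones of \<open>conv_parameters\<close>, with \<kappa> = lam R^\<alpha>.\<close>

lemma supersolution_ball:
  fixes u :: "real ^ 'n \<Rightarrow> real"
  assumes cont: "continuous_on UNIV u" and nonneg: "\<And>x. 0 \<le> u x" and pos: "\<And>x. x \<in> \<Omega> \<Longrightarrow> 0 < u x"
    and sup: "viscosity_supersolution \<alpha> lam \<Omega> u" and \<alpha>: "0 < \<alpha>" "\<alpha> \<le> 1"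
    and R: "0 < R" "ball z R \<subseteq> \<Omega>"
  shows "lam \<le> R powr (- \<alpha>)"
proof (rule ccontr)
  assume "\<not> lam \<le> R powr (- \<alpha>)"
  define \<rho> where "\<rho> = R powr \<alpha>"
  have \<rho>: "0 < \<rho>" using R by (simp add: \<rho>_def)
  have "1 < lam * \<rho>"
    using \<open>\<not> lam \<le> R powr (- \<alpha>)\<close> \<rho> by (simp add: \<rho>_def powr_minus field_simps)
  from conv_parameters[OF this] obtain \<epsilon> \<eta> where \<epsilon>: "0 < \<epsilon>" and \<eta>: "0 < \<eta>" "\<eta> < 1"
    and contra: "\<And>v. 0 < v \<Longrightarrow> v \<le> 1 \<Longrightarrow> lam * \<rho> * conv \<epsilon> v \<le> conv' \<epsilon> v \<Longrightarrow>
        conv \<epsilon> (1 - \<eta>) - conv \<epsilon> v \<le> conv' \<epsilon> v * (1 - v) \<Longrightarrow> False" by blast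
  \<comment> \<open>Chosen so that smoothing lowers the height of the cone at \<open>z\<close> from
    1 to exactly 1 - \<eta>.\<close>
  define \<delta> where "\<delta> = R * \<eta> powr (1 / \<alpha>)"
  have \<delta>: "0 < \<delta>" using R \<eta> by (simp add: \<delta>_def)
  have \<delta>\<rho>: "\<delta> powr \<alpha> / \<rho> = \<eta>"
    using R \<eta> \<alpha> \<rho> by (simp add: \<delta>_def \<rho>_def powr_mult powr_powr)
  define s where "s x = norm (x - z, \<delta>) powr \<alpha> / \<rho>" for x
  define v where "v x = max 0 (1 - s x)" for x
  define f where "f x = conv \<epsilon> (v x)" for x
  \<comment> \<open>Smoothing by an extra coordinate keeps the triangle inequality, so
    \<open>s\<close> has the same \<alpha>-Hoelder constant 1/\<rho> as the sharp cone.\<close>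
  have s_holder: "s y - s x \<le> norm (y - x) powr \<alpha> / \<rho>" for x y
  proof -
    have "norm (y - z, \<delta>) \<le> norm (x - z, \<delta>) + norm (y - x)"
      using norm_triangle_ineq[of "(x - z, \<delta>)" "(y - x, 0)"] by (simp add: norm_Pair)
    then have "norm (y - z, \<delta>) powr \<alpha> \<le> norm (x - z, \<delta>) powr \<alpha> + norm (y - x) powr \<alpha>"
      using \<alpha> by (intro powr_le_powr_add) auto
    then show ?thesis using \<rho> by (simp add: s_def diff_divide_distrib[symmetric] divide_right_mono)
  qed
  have s_ge: "norm (x - z) powr \<alpha> / \<rho> \<le> s x" for x
  proof -
    have "norm (x - z) \<le> norm (x - z, \<delta>)" by (simp add: norm_Pair real_le_rsqrt)
    then show ?thesis using \<rho> \<alpha> by (simp add: s_def divide_right_mono powr_mono2)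
  qed
  have s_z: "s z = \<eta>" using \<delta> \<delta>\<rho> by (simp add: s_def norm_Pair)
  have C1: "f \<in> C1_compact_support"
    using smoothed_cone_C1[OF \<epsilon> \<alpha>(1) R(1) \<delta>] by (simp add: f_def[abs_def] v_def s_def \<rho>_def)
  \<comment> \<open>A compact set inside the open ball, where \<open>u\<close> is positive, and off
    which \<open>f\<close> vanishes.\<close>
  define K where "K = cball z R \<inter> {x. s x \<le> 1}"
  have s_cont: "continuous_on UNIV s"
    unfolding s_def using \<rho> \<delta> by (intro continuous_intros) (auto simp: zero_prod_def)
  have "closed {x. s x \<le> 1}" by (intro closed_Collect_le continuous_intros s_cont)
  then have K: "compact K" by (simp add: K_def compact_Int_closed)
  have zK: "z \<in> K" using R s_z \<eta> by (simp add: K_def)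
  have s_le1: "norm (x - z) < R" if "s x \<le> 1" for x
  proof (rule ccontr)
    assume "\<not> norm (x - z) < R"
    then have "R\<^sup>2 \<le> (norm (x - z))\<^sup>2" using R by (intro power_mono) auto
    then have "R\<^sup>2 < (norm (x - z))\<^sup>2 + \<delta>\<^sup>2" using zero_less_power[OF \<delta>, of 2] by linarith
    then have "R < norm (x - z, \<delta>)" by (simp add: norm_Pair real_less_rsqrt)
    then have "\<rho> < norm (x - z, \<delta>) powr \<alpha>" unfolding \<rho>_def using R \<alpha> by (intro powr_less_mono2) auto
    then show False using that \<rho> by (simp add: s_def divide_le_eq)
  qed
  have K\<Omega>: "x \<in> \<Omega>" if "x \<in> K" for x
    using that s_le1[of x] R(2) by (auto simp: K_def dist_norm norm_minus_commute)
  have f_K: "f x = 0" if "x \<notin> K" for x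
  proof -
    have "1 < s x" using that s_le1[of x] by (fastforce simp: K_def dist_norm norm_minus_commute)
    then show ?thesis by (simp add: f_def v_def conv_def)
  qed
  have f_cont: "continuous_on UNIV f"
    unfolding f_def conv_def v_def
    by (intro continuous_intros s_cont) (use \<epsilon> in \<open>auto simp: max_def\<close>)
  have "continuous_on K (\<lambda>x. f x / u x)"
    using K\<Omega> pos by (intro continuous_intros continuous_on_subset[OF f_cont] continuous_on_subset[OF cont])
      force+
  \<comment> \<open>The contact point minimises u/f; the inverse quotient is maximised because
    \<open>f\<close> has zeros in \<open>K\<close>.\<close>
  then obtain x where x: "x \<in> K" "\<And>y. y \<in> K \<Longrightarrow> f y / u y \<le> f x / u x"
    using continuous_attains_sup[OF K] zK by blast
  have ux: "0 < u x" using pos K\<Omega> x by simp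
  have "0 < f z" using s_z \<eta> \<epsilon> by (simp add: f_def v_def conv_def)
  moreover have "0 < u z" using pos K\<Omega> zK by simp
  ultimately have "0 < f x / u x" using x(2)[OF zK] by (meson divide_pos_pos less_le_trans)
  then have fx: "0 < f x" using ux by (simp add: zero_less_divide_iff)
  define c where "c = u x / f x"
  have c: "0 < c" using ux fx by (simp add: c_def)
  let ?\<phi> = "\<lambda>w. c * f w"
  have le: "?\<phi> y \<le> u y" for y
  proof (cases "y \<in> K")
    case True
    then show ?thesis using x(2)[OF True] ux fx pos[OF K\<Omega>[OF True]] by (simp add: c_def field_simps)
  qed (use f_K nonneg in simp)
  have \<phi>x: "?\<phi> x = u x" using fx by (simp add: c_def)
  have "?\<phi> \<in> C1_compact_support" by (rule C1_compact_support_cmult[OF C1])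
  moreover have "touches_below ?\<phi> u x" using le \<phi>x by (simp add: touches_below_def)
  ultimately have vis: "L_inf \<alpha> ?\<phi> x \<le> 0" "L_minus \<alpha> ?\<phi> x + ereal (lam * ?\<phi> x) \<le> 0"
    using sup K\<Omega>[OF x(1)] unfolding viscosity_supersolution_def by blast+
  have vx: "0 < v x" using fx by (cases "v x = 0") (auto simp: f_def conv_def v_def)
  then have vs: "v x = 1 - s x" by (auto simp: v_def max_def split: if_splits)
  have s0: "0 \<le> s x" using \<rho> by (simp add: s_def)
  let ?k = "conv' \<epsilon> (v x) / \<rho>"
  have m: "ereal (- (c * ?k)) \<le> L_minus \<alpha> ?\<phi> x"
  proof (rule L_minus_ge)
    fix y
    \<comment> \<open>The truncation is inactive at \<open>x\<close> and can only raise
      \<open>v y\<close>, so the Hoelder bound for \<open>s\<close> passes to \<open>v\<close>; the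
      tangent of \<open>conv\<close> carries it to \<open>f\<close>.\<close>
    have "- (norm (y - x) powr \<alpha> / \<rho>) \<le> v y - v x"
      using s_holder[of y x] vs by (simp add: v_def)
    then have "conv' \<epsilon> (v x) * (- (norm (y - x) powr \<alpha> / \<rho>)) \<le> conv' \<epsilon> (v x) * (v y - v x)"
      by (rule mult_left_mono) (use conv'_bounds[OF \<epsilon>] vx in auto)
    also have "\<dots> \<le> f y - f x"
      unfolding f_def by (rule conv_above_tangent) (use \<epsilon> in \<open>auto simp: v_def\<close>)
    finally have "c * (conv' \<epsilon> (v x) * (- (norm (y - x) powr \<alpha> / \<rho>))) \<le> c * (f y - f x)"
      by (rule mult_left_mono) (use c in simp)
    then show "- (c * ?k) * norm (y - x) powr \<alpha> \<le> ?\<phi> y - ?\<phi> x" by (simp add: algebra_simps)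
  qed
  have "ereal (- (c * ?k)) + ereal (lam * ?\<phi> x) \<le> 0"
    using add_mono[OF m order_refl] vis(2) by (rule order_trans)
  then have "c * (lam * f x) \<le> c * ?k" by (simp add: mult.left_commute)
  then have "lam * f x \<le> ?k" by (simp only: mult_le_cancel_left_pos[OF c])
  then have 1: "lam * \<rho> * conv \<epsilon> (v x) \<le> conv' \<epsilon> (v x)"
    using \<rho> by (simp add: f_def field_simps)
  \<comment> \<open>In \<open>L_inf\<close> the upper operator is tested only towards the centre
    \<open>z\<close>, where \<open>f\<close> has the value
    \<open>conv \<epsilon> (1 - \<eta>)\<close>.\<close>
  have "f z - f x \<le> ?k * norm (z - x) powr \<alpha>"
  proof (cases "z = x")
    case False
    have "ereal ((?\<phi> z - ?\<phi> x) / norm (z - x) powr \<alpha>) + ereal (- (c * ?k)) \<le> 0"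
      using add_mono[OF L_plus_ge[OF False] m] vis(1) unfolding L_inf_def by (rule order_trans)
    then have "c * (f z - f x) \<le> c * (?k * norm (z - x) powr \<alpha>)"
      using False by (simp add: divide_le_eq algebra_simps)
    then show ?thesis by (simp only: mult_le_cancel_left_pos[OF c])
  qed simp
  also have "\<dots> \<le> conv' \<epsilon> (v x) * s x"
    using mult_left_mono[OF s_ge[of x] conv'_bounds(1)[OF \<epsilon>, of "v x"]] vx
    by (simp add: norm_minus_commute)
  finally have 2: "conv \<epsilon> (1 - \<eta>) - conv \<epsilon> (v x) \<le> conv' \<epsilon> (v x) * (1 - v x)"
    using s_z \<eta> vs by (simp add: f_def v_def)
  show False by (rule contra[OF vx _ 1 2]) (use vs s0 in simp)
qed

section \<open>Comparison at an incentre and at a maximum point\<close>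

theorem theorem33:
  fixes \<Omega> :: "(real ^ 'n) set" and u :: "real ^ 'n \<Rightarrow> real" and \<alpha> lam :: real
  assumes "open \<Omega>" and "connected \<Omega>" and "\<Omega> \<noteq> {}" and "bounded \<Omega>"
    and "0 < \<alpha>" and "\<alpha> \<le> 1"
    and "u \<in> C0_closure \<Omega>"
    and "\<exists>x. u x \<noteq> 0"
    and "\<forall>x. 0 \<le> u x"
    and "viscosity_solution \<alpha> lam \<Omega> u"
  shows "lam = inradius \<Omega> powr (- \<alpha>)"
proof -
  have cont: "continuous_on UNIV u" by (rule C0_closure_continuous) fact+
  have zero: "u x = 0" if "x \<notin> \<Omega>" for x using C0_closure_zero assms that by blast
  have nonneg: "0 \<le> u x" for x using assms by blast
  obtain a where a: "u a \<noteq> 0" using assms by blast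
  have sub: "viscosity_subsolution \<alpha> lam \<Omega> u" and sup: "viscosity_supersolution \<alpha> lam \<Omega> u"
    using assms by (auto simp: viscosity_solution_def)
  have pos: "0 < u x" if "x \<in> \<Omega>" for x by (rule supersolution_pos[OF cont nonneg a sup that])
  obtain z where z: "z \<in> \<Omega>" "infdist z (- \<Omega>) = inradius \<Omega>" "\<And>y. y \<in> \<Omega> \<Longrightarrow> infdist y (- \<Omega>) \<le> inradius \<Omega>"
    using inradius_is_max[OF \<open>open \<Omega>\<close> \<open>\<Omega> \<noteq> {}\<close> \<open>bounded \<Omega>\<close>] by metis
  have cl: "closed (- \<Omega>)" using assms by (simp add: closed_Compl)
  have ne: "- \<Omega> \<noteq> {}"
    using assms(4) not_bounded_UNIV by (metis Compl_empty_eq double_complement)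
  have "ball z (inradius \<Omega>) \<subseteq> \<Omega>"
    using infdist_le[of _ "- \<Omega>" z] z(2) by fastforce
  moreover have "0 < inradius \<Omega>"
    using in_closed_iff_infdist_zero[OF cl ne, of z] z infdist_nonneg[of z "- \<Omega>"] by auto
  ultimately have upper: "lam \<le> inradius \<Omega> powr (- \<alpha>)"
    using supersolution_ball[OF cont nonneg pos sup] assms by blast
  have "compact (closure \<Omega>)" "closure \<Omega> \<noteq> {}" using assms by auto
  then obtain x where x: "\<And>w. w \<in> closure \<Omega> \<Longrightarrow> u w \<le> u x"
    using continuous_attains_sup[OF _ _ continuous_on_subset[OF cont]] by (metis subset_UNIV)
  have max: "u w \<le> u x" for w
    using x[of w] zero[of w] nonneg[of x] closure_subset[of \<Omega>] by fastforce
  have ux: "0 < u x" using max[of z] pos[OF z(1)] by linarith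
  then have x\<Omega>: "x \<in> \<Omega>" using zero by fastforce
  obtain y where y: "y \<in> - \<Omega>" "infdist x (- \<Omega>) = dist x y"
    using infdist_attains_inf[OF cl ne] by metis
  have "y \<noteq> x" using y x\<Omega> by blast
  \<comment> \<open>The nearest point of the complement to the maximum point is at distance at most
    the inradius, and the negative exponent reverses the inequality.\<close>
  have "inradius \<Omega> powr (- \<alpha>) \<le> norm (y - x) powr (- \<alpha>)"
    by (rule powr_mono2') (use z(3)[OF x\<Omega>] y \<open>y \<noteq> x\<close> assms in \<open>auto simp: dist_norm norm_minus_commute\<close>)
  also have "\<dots> \<le> lam"
    by (rule subsolution_at_max[OF cont \<open>bounded \<Omega>\<close> zero sub x\<Omega> max ux]) (use y zero in auto)
  finally show ?thesis using upper by simp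
qed

end
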